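(* Let $B$ be a fixed bipartite graph whose vertex set is covered by pairwise vertex-disjoint edges together with possibly one (vertex-disjoint) star $S_j$ with $j\ge 2$ leaves. Then for integers $e=e_n$ with $e/n\to\infty$ and $e\le n^2/4$, $$ex_{bip}(n,e,B)=(1+o(1))\,N(B,B^e_n)\qquad(n\to\infty).$$
   Context: $S_j$ denotes the star with $j$ leaves. For graphs $H,G$, $N(H,G)$ is the number of subgraphs of $G$ isomorphic to $H$. $ex_{bip}(n,e,H)=\max\{N(H,G): G \text{ bipartite}, |V(G)|=n, |E(G)|=e\}$. For positive integers $n,e$ with $e\le n^2/4$, let $t$ be the smallest positive integer $i$ with $i(n-i)\ge e$; the graph $B^e_n$ is obtained from $K_{t,n-t}$ by picking a vertex of degree $n-t$ and deleting $t(n-t)-e$ of its edges. *)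

theory Defs
  imports Complex_Main "HOL-Library.Landau_Symbols"
begin

section \<open>Finite simple graphs\<close>

datatype 'a graph = Graph (verts: "'a set") (edges: "'a set set")

definition simple_graph :: "'a graph \<Rightarrow> bool" where
  "simple_graph G \<longleftrightarrow> finite (verts G) \<and> (\<forall>d\<in>edges G. d \<subseteq> verts G \<and> card d = 2)"

definition bipartite :: "'a graph \<Rightarrow> bool" where
  "bipartite G \<longleftrightarrow> (\<exists>X Y. X \<inter> Y = {} \<and> X \<union> Y = verts G \<and>
     (\<forall>d\<in>edges G. \<exists>x\<in>X. \<exists>y\<in>Y. d = {x, y}))"

definition subgraph :: "'a graph \<Rightarrow> 'a graph \<Rightarrow> bool" where
  "subgraph H G \<longleftrightarrow> simple_graph H \<and> verts H \<subseteq> verts G \<and> edges H \<subseteq> edges G"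

definition isomorphic :: "'a graph \<Rightarrow> 'b graph \<Rightarrow> bool" where
  "isomorphic H G \<longleftrightarrow> (\<exists>f. bij_betw f (verts H) (verts G) \<and>
     (\<forall>u\<in>verts H. \<forall>v\<in>verts H. {u, v} \<in> edges H \<longleftrightarrow> {f u, f v} \<in> edges G))"

definition num_copies :: "'a graph \<Rightarrow> 'b graph \<Rightarrow> nat" where
  "num_copies H G = card {S. subgraph S G \<and> isomorphic H S}"

definition star :: "nat \<Rightarrow> nat graph" where
  "star j = Graph {0..j} {{0, i} | i. i \<in> {1..j}}"

definition edges_and_star_cover :: "'a graph \<Rightarrow> bool" where
  "edges_and_star_cover B \<longleftrightarrow> (\<exists>M \<subseteq> edges B. (\<forall>c\<in>M. \<forall>d\<in>M. c \<noteq> d \<longrightarrow> c \<inter> d = {}) \<and>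
     (verts B = \<Union>M \<or>
      (\<exists>S j. j \<ge> 2 \<and> subgraph S B \<and> isomorphic S (star j) \<and>
         verts S \<inter> \<Union>M = {} \<and> verts B = verts S \<union> \<Union>M)))"


section \<open>The extremal function\<close>

definition bip_graphs :: "nat \<Rightarrow> nat \<Rightarrow> nat graph set" where
  "bip_graphs n e =
     {G. simple_graph G \<and> bipartite G \<and> card (verts G) = n \<and> card (edges G) = e}"

text \<open>
  The maximum is over a finite set of values (lemma \<open>finite_num_copies_bip_graphs\<close>), which is
  nonempty whenever \<open>0 < e\<close> and \<open>4 * e \<le> n ^ 2\<close> (lemma \<open>B_graph_in_bip_graphs\<close>). Outside the
  range where bipartite graphs with these parameters exist, the value is unspecified.
\<close>

definition ex_bip :: "nat \<Rightarrow> nat \<Rightarrow> 'a graph \<Rightarrow> nat" where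
  "ex_bip n e H = Max (num_copies H ` bip_graphs n e)"


section \<open>The graph $B^e_n$\<close>

definition complete_bip :: "nat \<Rightarrow> nat \<Rightarrow> nat graph" where
  "complete_bip a b = Graph {..<a + b} {{u, v} | u v. u \<in> {..<a} \<and> v \<in> {a..<a + b}}"

text \<open>
  Subtraction is truncated, so for \<open>e > 0\<close> the condition \<open>e \<le> i * (n - i)\<close> forces \<open>i < n\<close>.
\<close>

definition part_size :: "nat \<Rightarrow> nat \<Rightarrow> nat" where
  "part_size n e = (LEAST i. 0 < i \<and> e \<le> i * (n - i))"

text \<open>
  Vertex \<open>0\<close> lies in the part of size \<open>t\<close>, hence has degree \<open>n - t\<close>; the deleted edges join it to
  the first \<open>t * (n - t) - e\<close> vertices of the other part. All other choices of the vertex and of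
  the deleted edges give isomorphic graphs.
\<close>

definition B_graph :: "nat \<Rightarrow> nat \<Rightarrow> nat graph" where
  "B_graph n e = (let t = part_size n e; K = complete_bip t (n - t) in
     Graph (verts K) (edges K - {{0, v} | v. v \<in> {t..<t + (t * (n - t) - e)}}))"


section \<open>Well-definedness\<close>

lemma finite_num_copies_bip_graphs: "finite (num_copies H ` bip_graphs n e)"
proof (rule finite_subset)
  show "num_copies H ` bip_graphs n e \<subseteq> {..2 ^ n * 2 ^ (2 ^ n)}"
  proof clarsimp
    fix G assume "G \<in> bip_graphs n e"
    then have G: "simple_graph G" and n: "card (verts G) = n"
      by (auto simp: bip_graphs_def)
    have fv: "finite (verts G)" and EP: "edges G \<subseteq> Pow (verts G)"
      using G by (auto simp: simple_graph_def)
    then have fe: "finite (edges G)" and ce: "card (edges G) \<le> 2 ^ n"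
      using finite_subset card_mono[of "Pow (verts G)" "edges G"] n
      by (auto simp: card_Pow)
    let ?S = "{S. subgraph S G \<and> isomorphic H S}"
    let ?P = "Pow (verts G) \<times> Pow (edges G)"
    have "card ?S \<le> card ?P"
    proof (rule card_inj_on_le)
      show "inj_on (\<lambda>S. (verts S, edges S)) ?S"
        by (auto simp: inj_on_def intro: graph.expand)
      show "(\<lambda>S. (verts S, edges S)) ` ?S \<subseteq> ?P"
        by (auto simp: subgraph_def)
      show "finite ?P"
        using fv fe by simp
    qed
    also have "card ?P = 2 ^ n * 2 ^ card (edges G)"
      using fv fe n by (simp add: card_cartesian_product card_Pow)
    also have "\<dots> \<le> 2 ^ n * 2 ^ (2 ^ n)"
      using ce by (simp add: power_increasing)
    finally show "num_copies H G \<le> 2 ^ n * 2 ^ (2 ^ n)"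
      by (simp add: num_copies_def)
  qed
qed simp

lemma part_size:
  assumes "0 < e" "4 * e \<le> n ^ 2"
  shows "0 < part_size n e" "part_size n e < n" "e \<le> part_size n e * (n - part_size n e)"
    "part_size n e * (n - part_size n e) - e \<le> n - part_size n e"
proof -
  have "n ^ 2 \<le> 4 * ((n div 2) * (n - n div 2)) + 1"
  proof (cases "even n")
    case True
    then obtain k where "n = 2 * k" by blast
    then show ?thesis by (simp add: power2_eq_square)
  next
    case False
    then obtain k where k: "n = 2 * k + 1" using oddE by blast
    then have "n div 2 = k" "n - k = k + 1" by auto
    with k show ?thesis by (simp add: power2_eq_square algebra_simps)
  qed
  with assms have e: "e \<le> (n div 2) * (n - n div 2)" by linarith
  moreover from e assms have "0 < n div 2" by (metis bot_nat_0.extremum_uniqueI gr0I mult_0 not_less0)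
  ultimately have ex: "\<exists>i. 0 < i \<and> e \<le> i * (n - i)" by blast
  define t where "t = part_size n e"
  have t: "0 < t" "e \<le> t * (n - t)"
    using LeastI_ex[OF ex] by (auto simp: t_def part_size_def)
  with assms have tn: "t < n" by (metis diff_is_0_eq' mult_0_right not_le)
  have least: "i * (n - i) < e" if "0 < i" "i < t" for i
    using not_less_Least[of i "\<lambda>i. 0 < i \<and> e \<le> i * (n - i)"] that
    by (auto simp: t_def part_size_def)
  have "t * (n - t) \<le> e + (n - t)"
  proof (cases "t = 1")
    case False
    with t have "(t - 1) * (n - (t - 1)) < e" using least[of "t - 1"] by simp
    moreover have "(t - 1) * (n - t) \<le> (t - 1) * (n - (t - 1))" by (intro mult_le_mono2 diff_le_mono2) simp
    moreover have "t * (n - t) = (t - 1) * (n - t) + (n - t)"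
      using t by (cases t) auto
    ultimately show ?thesis by linarith
  qed simp
  then have "t * (n - t) - e \<le> n - t" by linarith
  with t tn show "0 < part_size n e" "part_size n e < n"
    "e \<le> part_size n e * (n - part_size n e)"
    "part_size n e * (n - part_size n e) - e \<le> n - part_size n e"
    by (simp_all add: t_def)
qed

lemma B_graph_in_bip_graphs:
  assumes "0 < e" "4 * e \<le> n ^ 2"
  shows "B_graph n e \<in> bip_graphs n e"
proof -
  define t where "t = part_size n e"
  define r where "r = t * (n - t) - e"
  note t = part_size[OF assms, folded t_def, folded r_def]
  define P where "P = (\<lambda>(u, v). {u, v :: nat}) ` ({..<t} \<times> {t..<n})"
  define D where "D = (\<lambda>v. {0, v :: nat}) ` {t..<t + r}"
  have P: "{{u, v} | u v. u \<in> {..<t} \<and> v \<in> {t..<n}} = P"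
    unfolding P_def by (auto simp: image_iff) metis
  have D: "{{0, v} | v. v \<in> {t..<t + r}} = D"
    unfolding D_def by blast
  have "t + (n - t) = n" using t(2) by simp
  then have B: "B_graph n e = Graph {..<n} (P - D)"
    by (simp only: B_graph_def complete_bip_def Let_def t_def[symmetric] r_def[symmetric]
        graph.sel P D)
  have "card P = t * (n - t)"
    unfolding P_def by (subst card_image) (auto simp: inj_on_def doubleton_eq_iff)
  moreover have "card D = r"
    unfolding D_def by (subst card_image) (auto simp: inj_on_def doubleton_eq_iff)
  moreover have "D \<subseteq> P"
  proof
    fix d assume "d \<in> D"
    then obtain v where "d = {0, v}" "t \<le> v" "v < t + r" by (auto simp: D_def)
    with t show "d \<in> P" by (auto simp: P_def intro!: image_eqI[of _ _ "(0, v)"])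
  qed
  moreover have "finite P" by (simp add: P_def)
  ultimately have "card (P - D) = e"
    using t(3) by (simp add: card_Diff_subset finite_subset r_def)
  moreover have "simple_graph (B_graph n e)"
    using t(2) by (auto simp: B simple_graph_def P_def card_insert_if)
  moreover have "bipartite (B_graph n e)"
    unfolding bipartite_def B using t(2)
    by (intro exI[of _ "{..<t}"] exI[of _ "{t..<n}"]) (fastforce simp: P_def)
  ultimately show ?thesis by (simp add: bip_graphs_def B)
qed

end

theory Submission
  imports Defs "HOL-Library.FuncSet"
begin

text \<open>
  Counting embeddings instead of copies changes both sides by the same factor \<open>|Aut B|\<close>. After moving
  one edge of the star to the matching, \<open>B\<close> is covered by a matching \<open>M\<close> and a set \<open>L\<close> of leaves at
  one vertex. Sort the embeddings of \<open>B\<close> into a bipartite graph with parts of sizes \<open>x\<close> and \<open>y\<close> by the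
  proper 2-colouring of \<open>B\<close> that they induce, and pair each colouring with its complement. A pair
  accounts for at most \<open>e^|M| (x^|L| + y^|L|)\<close> embeddings: choose the images of the matching edges and
  then those of the leaves, which lie in a prescribed part. With \<open>t\<close> the part size of \<open>B_graph n e\<close>, both
  \<open>x\<close> and \<open>y\<close> are at least \<open>t\<close>, so convexity and \<open>e \<le> t (n - t)\<close> bound this by the corresponding number
  of maps into the complete bipartite graph with parts \<open>t\<close> and \<open>n - t\<close>. Since \<open>t \<ge> e / n\<close> tends to
  infinity, almost all of these maps are injective and avoid the one vertex at which \<open>B_graph n e\<close>
  lacks edges.
\<close>

section \<open>Embeddings, isomorphisms and copies\<close>

definition embeddings :: "'a graph \<Rightarrow> 'b graph \<Rightarrow> ('a \<Rightarrow> 'b) set" where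
  "embeddings H G = {f \<in> verts H \<rightarrow>\<^sub>E verts G. inj_on f (verts H) \<and> (\<forall>d\<in>edges H. f ` d \<in> edges G)}"

text \<open>Extensional functions, so that each isomorphism is counted once. Edges are matched as
  whole image sets, which makes composition, inversion and the splitting of embeddings by their
  image direct.\<close>

definition isomorphisms :: "'a graph \<Rightarrow> 'b graph \<Rightarrow> ('a \<Rightarrow> 'b) set" where
  "isomorphisms H G = {f \<in> verts H \<rightarrow>\<^sub>E verts G. bij_betw f (verts H) (verts G) \<and> image f ` edges H = edges G}"

lemma simple_graph_edgeE:
  assumes "simple_graph G" "d \<in> edges G"
  obtains u v where "u \<in> verts G" "v \<in> verts G" "u \<noteq> v" "d = {u, v}"
  using assms unfolding simple_graph_def card_2_iff by fastforce

lemma edge_subset_verts: "simple_graph G \<Longrightarrow> d \<in> edges G \<Longrightarrow> d \<subseteq> verts G"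
  by (auto simp: simple_graph_def)

lemma finite_edges: "simple_graph G \<Longrightarrow> finite (edges G)"
  unfolding simple_graph_def by (meson PowI finite_Pow_iff finite_subset subsetI)

lemma finite_embeddings:
  assumes "simple_graph H" "simple_graph G"
  shows "finite (embeddings H G)"
  by (rule finite_subset[of _ "verts H \<rightarrow>\<^sub>E verts G"])
     (use assms in \<open>auto simp: embeddings_def simple_graph_def intro!: finite_PiE\<close>)

lemma isomorphisms_imp_isomorphic:
  assumes H: "simple_graph H" and f: "f \<in> isomorphisms H G"
  shows "isomorphic H G"
  unfolding isomorphic_def
proof (intro exI conjI ballI)
  show b: "bij_betw f (verts H) (verts G)" using f by (simp add: isomorphisms_def)
  have E: "image f ` edges H = edges G" using f by (simp add: isomorphisms_def)
  fix u v assume uv: "u \<in> verts H" "v \<in> verts H"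
  have "{f u, f v} \<in> edges G \<longleftrightarrow> f ` {u, v} \<in> image f ` edges H" using E by simp
  also have "\<dots> \<longleftrightarrow> {u, v} \<in> edges H"
  proof
    assume "f ` {u, v} \<in> image f ` edges H"
    then obtain d where d: "d \<in> edges H" "f ` {u, v} = f ` d" by blast
    then have "{u, v} = d"
      using inj_on_image_eq_iff[of f "verts H" "{u, v}" d] b uv edge_subset_verts[OF H d(1)]
      by (auto simp: bij_betw_def)
    with d show "{u, v} \<in> edges H" by simp
  qed blast
  finally show "{u, v} \<in> edges H \<longleftrightarrow> {f u, f v} \<in> edges G" by simp
qed

lemma isomorphic_imp_isomorphisms:
  assumes H: "simple_graph H" and G: "simple_graph G" and "isomorphic H G"
  shows "isomorphisms H G \<noteq> {}"
proof -
  obtain f where b: "bij_betw f (verts H) (verts G)"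
    and e: "\<And>u v. u \<in> verts H \<Longrightarrow> v \<in> verts H \<Longrightarrow> {u, v} \<in> edges H \<longleftrightarrow> {f u, f v} \<in> edges G"
    using assms(3) unfolding isomorphic_def by blast
  let ?g = "restrict f (verts H)"
  have gd: "?g ` d = f ` d" if "d \<subseteq> verts H" for d using that by (auto simp: image_iff)
  have "image ?g ` edges H = edges G"
  proof (intro equalityI subsetI)
    fix x assume "x \<in> image ?g ` edges H"
    then obtain d where d: "d \<in> edges H" "x = ?g ` d" by blast
    obtain u v where uv: "u \<in> verts H" "v \<in> verts H" "d = {u, v}"
      using simple_graph_edgeE[OF H d(1)] by metis
    then show "x \<in> edges G" using d e[of u v] by simp
  next
    fix x assume x: "x \<in> edges G"
    obtain a c where ac: "a \<in> verts G" "c \<in> verts G" "x = {a, c}"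
      using simple_graph_edgeE[OF G x] by metis
    then obtain u v where uv: "u \<in> verts H" "v \<in> verts H" "a = f u" "c = f v"
      using b by (metis bij_betw_imp_surj_on imageE)
    then have "{u, v} \<in> edges H" using e x ac by auto
    moreover have "x = ?g ` {u, v}" using uv ac by simp
    ultimately show "x \<in> image ?g ` edges H" by blast
  qed
  moreover have "bij_betw ?g (verts H) (verts G)" using b bij_betw_restrict_eq by blast
  ultimately have "?g \<in> isomorphisms H G"
    using b by (auto simp: isomorphisms_def bij_betw_apply)
  then show ?thesis by blast
qed

lemma compose_isomorphisms:
  assumes "simple_graph F" "f \<in> isomorphisms F G" "g \<in> isomorphisms G H"
  shows "compose (verts F) g f \<in> isomorphisms F H"
proof -
  have "bij_betw (compose (verts F) g f) (verts F) (verts H)"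
    using assms bij_betw_compose by (auto simp: isomorphisms_def)
  moreover have "compose (verts F) g f ` d = g ` f ` d" if "d \<in> edges F" for d
    using edge_subset_verts[OF assms(1) that] by (force simp: compose_def)
  then have "image (compose (verts F) g f) ` edges F = image g ` image f ` edges F"
    by (simp add: image_image)
  then have "image (compose (verts F) g f) ` edges F = edges H"
    using assms by (simp add: isomorphisms_def)
  ultimately show ?thesis
    by (simp add: isomorphisms_def PiE_iff bij_betw_apply)
qed

lemma inverse_isomorphism:
  assumes "simple_graph G" "h \<in> isomorphisms G H"
  shows "restrict (inv_into (verts G) h) (verts H) \<in> isomorphisms H G" (is "?g \<in> _")
proof -
  have b: "bij_betw h (verts G) (verts H)" using assms by (simp add: isomorphisms_def)
  then have b': "bij_betw ?g (verts H) (verts G)"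
    using bij_betw_inv_into bij_betw_restrict_eq by blast
  have "?g ` h ` d = d" if "d \<in> edges G" for d
  proof -
    have d: "d \<subseteq> verts G" using edge_subset_verts[OF assms(1) that] .
    then have "?g ` h ` d = inv_into (verts G) h ` h ` d"
      using b by (intro image_cong) (auto simp: bij_betw_def)
    then show ?thesis using d b by (simp add: bij_betw_def)
  qed
  moreover have "edges H = image h ` edges G" using assms by (simp add: isomorphisms_def)
  ultimately have "image ?g ` edges H = edges G" by (simp only: image_image image_ident cong: image_cong)
  with b' show ?thesis by (auto simp: isomorphisms_def bij_betw_apply)
qed

text \<open>Composition with one fixed isomorphism \<open>h\<close> turns automorphisms of
  \<open>H\<close> into isomorphisms from \<open>H\<close> to \<open>G\<close>; composition with its
  inverse \<open>g\<close> goes back.\<close>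

lemma card_isomorphisms:
  assumes H: "simple_graph H" and G: "simple_graph G" and "isomorphic H G"
  shows "card (isomorphisms H G) = card (isomorphisms H H)"
proof -
  obtain h where h: "h \<in> isomorphisms H G"
    using isomorphic_imp_isomorphisms[OF assms] by blast
  define g where "g = restrict (inv_into (verts H) h) (verts G)"
  have g: "g \<in> isomorphisms G H" unfolding g_def by (rule inverse_isomorphism[OF H h])
  have hb: "bij_betw h (verts H) (verts G)" using h by (simp add: isomorphisms_def)
  have gh: "g (h x) = x" if "x \<in> verts H" for x
    using hb that by (auto simp: g_def bij_betw_def)
  have hg: "h (g x) = x" if "x \<in> verts G" for x
    using hb that by (auto simp: g_def bij_betw_def f_inv_into_f)
  have "bij_betw (compose (verts H) h) (isomorphisms H H) (isomorphisms H G)"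
  proof (rule bij_betw_byWitness[where f' = "compose (verts H) g"])
    show "compose (verts H) h ` isomorphisms H H \<subseteq> isomorphisms H G"
      using compose_isomorphisms[OF H _ h] by blast
    show "compose (verts H) g ` isomorphisms H G \<subseteq> isomorphisms H H"
      using compose_isomorphisms[OF H _ g] by blast
    show "\<forall>a\<in>isomorphisms H H. compose (verts H) g (compose (verts H) h a) = a"
    proof
      fix a assume "a \<in> isomorphisms H H"
      then have a: "a \<in> verts H \<rightarrow>\<^sub>E verts H" by (simp add: isomorphisms_def)
      then show "compose (verts H) g (compose (verts H) h a) = a"
        by (intro extensionalityI[of _ "verts H"]) (auto simp: compose_def PiE_def Pi_def gh)
    qed
    show "\<forall>a\<in>isomorphisms H G. compose (verts H) h (compose (verts H) g a) = a"
    proof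
      fix a assume "a \<in> isomorphisms H G"
      then have a: "a \<in> verts H \<rightarrow>\<^sub>E verts G" by (simp add: isomorphisms_def)
      then show "compose (verts H) h (compose (verts H) g a) = a"
        by (intro extensionalityI[of _ "verts H"]) (auto simp: compose_def PiE_def Pi_def hg)
    qed
  qed
  then show ?thesis by (simp add: bij_betw_same_card)
qed

lemma card_isomorphisms_pos:
  assumes H: "simple_graph H"
  shows "0 < card (isomorphisms H H)"
proof -
  have "isomorphic H H" unfolding isomorphic_def by (rule exI[of _ id]) auto
  then have "isomorphisms H H \<noteq> {}" using isomorphic_imp_isomorphisms H by blast
  moreover have "finite (isomorphisms H H)"
    by (rule finite_subset[of _ "verts H \<rightarrow>\<^sub>E verts H"])
       (use H in \<open>auto simp: isomorphisms_def simple_graph_def intro!: finite_PiE\<close>)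
  ultimately show ?thesis by (simp add: card_gt_0_iff)
qed

text \<open>Each embedding is an isomorphism onto exactly one copy, its image, and each copy is hit
  by as many embeddings as \<open>H\<close> has automorphisms. The factor does not depend on
  \<open>G\<close>, so it cancels when two host graphs are compared.\<close>

lemma card_embeddings:
  assumes H: "simple_graph H" and G: "simple_graph G"
  shows "card (embeddings H G) = num_copies H G * card (isomorphisms H H)"
proof -
  let ?C = "{S. subgraph S G \<and> isomorphic H S}"
  have fC: "finite ?C"
  proof (rule finite_imageD)
    show "inj_on (\<lambda>S. (verts S, edges S)) ?C" by (auto simp: inj_on_def intro: graph.expand)
    have "(\<lambda>S. (verts S, edges S)) ` ?C \<subseteq> Pow (verts G) \<times> Pow (edges G)"
      by (auto simp: subgraph_def)
    then show "finite ((\<lambda>S. (verts S, edges S)) ` ?C)"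
      using finite_edges[OF G] G by (rule_tac finite_subset) (auto simp: simple_graph_def)
  qed
  have U: "embeddings H G = (\<Union>S\<in>?C. isomorphisms H S)"
  proof (intro equalityI subsetI)
    fix f assume f: "f \<in> embeddings H G"
    let ?S = "Graph (f ` verts H) (image f ` edges H)"
    have "card (f ` d) = 2 \<and> f ` d \<subseteq> f ` verts H" if d: "d \<in> edges H" for d
    proof -
      have "d \<subseteq> verts H" "card d = 2" using H d by (auto simp: simple_graph_def)
      then show ?thesis using f by (auto simp: embeddings_def card_image inj_on_subset)
    qed
    then have s: "simple_graph ?S" using H by (auto simp: simple_graph_def)
    then have "subgraph ?S G" using f by (auto simp: subgraph_def embeddings_def)
    moreover have fS: "f \<in> isomorphisms H ?S"
      using f by (auto simp: isomorphisms_def embeddings_def bij_betw_def)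
    ultimately show "f \<in> (\<Union>S\<in>?C. isomorphisms H S)"
      using isomorphisms_imp_isomorphic[OF H fS] by blast
  next
    fix f assume "f \<in> (\<Union>S\<in>?C. isomorphisms H S)"
    then obtain S where "subgraph S G" "f \<in> isomorphisms H S" by blast
    then show "f \<in> embeddings H G"
      by (auto simp: subgraph_def isomorphisms_def embeddings_def bij_betw_def)
  qed
  have fin: "finite (isomorphisms H S)" if "S \<in> ?C" for S
    by (rule finite_subset[OF _ finite_embeddings[OF H G]]) (use U that in blast)
  have "card (embeddings H G) = (\<Sum>S\<in>?C. card (isomorphisms H S))"
    unfolding U
  proof (rule card_UN_disjoint[OF fC])
    show "\<forall>S\<in>?C. \<forall>T\<in>?C. S \<noteq> T \<longrightarrow> isomorphisms H S \<inter> isomorphisms H T = {}"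
      by (auto simp: isomorphisms_def bij_betw_def intro: graph.expand)
  qed (use fin in blast)
  also have "\<dots> = (\<Sum>S\<in>?C. card (isomorphisms H H))"
    by (intro sum.cong refl card_isomorphisms[OF H]) (auto simp: subgraph_def)
  finally show ?thesis by (simp add: num_copies_def)
qed

section \<open>Proper 2-colourings and a lower bound for embeddings\<close>

text \<open>A proper 2-colouring is encoded by one of its colour classes \<open>c\<close>; the other
  class is \<open>verts H - c\<close>.\<close>

definition two_colourings :: "'a graph \<Rightarrow> 'a set set" where
  "two_colourings H = {c. c \<subseteq> verts H \<and> (\<forall>u v. {u, v} \<in> edges H \<longrightarrow> (u \<in> c \<longleftrightarrow> v \<notin> c))}"

lemma finite_two_colourings: "simple_graph H \<Longrightarrow> finite (two_colourings H)"
  by (rule finite_subset[of _ "Pow (verts H)"]) (auto simp: two_colourings_def simple_graph_def)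

lemma two_colouring_subset: "c \<in> two_colourings H \<Longrightarrow> c \<subseteq> verts H"
  by (simp add: two_colourings_def)

lemma complement_two_colouring:
  assumes "simple_graph H" "c \<in> two_colourings H"
  shows "verts H - c \<in> two_colourings H"
  using assms by (auto simp: two_colourings_def dest!: edge_subset_verts)

text \<open>Complementation is an involution on the colourings. This lets twice a sum over
  colourings be read as a sum over complementary pairs.\<close>

lemma sum_two_colourings_complement:
  assumes H: "simple_graph H"
  shows "(\<Sum>c\<in>two_colourings H. g (verts H - c)) = (\<Sum>c\<in>two_colourings H. g c)"
  by (rule sum.reindex_bij_witness[where i = "\<lambda>c. verts H - c" and j = "\<lambda>c. verts H - c"])
     (use complement_two_colouring[OF H] in \<open>auto simp: double_diff dest: two_colouring_subset\<close>)

text \<open>The number of injections is a falling factorial, each factor of which is at least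
  \<open>card B - card A\<close>. Truncation is harmless: if \<open>A\<close> is larger than
  \<open>B\<close>, the left side is 0.\<close>

lemma card_injections_ge:
  assumes "finite A" "finite B"
  shows "(card B - card A) ^ card A \<le> card {f \<in> A \<rightarrow>\<^sub>E B. inj_on f A}"
proof -
  have "(card B - card A) ^ card A = (\<Prod>i = 0..<card A. card B - card A)" by simp
  also have "\<dots> \<le> (\<Prod>i = 0..<card A. card B - i)" by (rule prod_mono) auto
  finally show ?thesis using card_inj_on_subset_funcset[OF assms, of A] by simp
qed

text \<open>Every edge of \<open>H\<close> joins \<open>c\<close> to its complement, so any
  injections of \<open>c\<close> into \<open>P\<close> and of the complement into \<open>Q\<close>
  glue to an embedding. Distinct colourings yield distinct embeddings because \<open>P\<close> and
  \<open>Q\<close> are disjoint.\<close>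

lemma card_embeddings_ge:
  assumes H: "simple_graph H" and G: "simple_graph G"
    and PQ: "P \<subseteq> verts G" "Q \<subseteq> verts G" "P \<inter> Q = {}"
    and E: "\<And>p q. p \<in> P \<Longrightarrow> q \<in> Q \<Longrightarrow> {p, q} \<in> edges G"
  shows "(\<Sum>c\<in>two_colourings H. (card P - card (verts H)) ^ card c *
            (card Q - card (verts H)) ^ card (verts H - c)) \<le> card (embeddings H G)"
proof -
  let ?V = "verts H"
  define F where "F c = {f \<in> embeddings H G. f ` c \<subseteq> P \<and> f ` (?V - c) \<subseteq> Q}" for c
  have fV: "finite ?V" and fG: "finite (verts G)" using H G by (auto simp: simple_graph_def)
  have fPQ: "finite P" "finite Q" using finite_subset[OF PQ(1) fG] finite_subset[OF PQ(2) fG] by auto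
  have fF: "finite (F c)" for c
    by (rule finite_subset[OF _ finite_embeddings[OF H G]]) (auto simp: F_def)
  have "(card P - card ?V) ^ card c * (card Q - card ?V) ^ card (?V - c) \<le> card (F c)"
    if c: "c \<in> two_colourings H" for c
  proof -
    have cV: "c \<subseteq> ?V" using c by (simp add: two_colourings_def)
    then have fc: "finite c" using fV finite_subset by blast
    let ?I = "\<lambda>A B. {f \<in> A \<rightarrow>\<^sub>E (B :: 'b set). inj_on f A}"
    let ?j = "\<lambda>(f, g). \<lambda>x\<in>?V. if x \<in> c then f x else (g x :: 'b)"
    \<comment> \<open>The weaker base \<open>card P - card ?V\<close> is the same for all
      colourings, which later allows the powers for \<open>c\<close> and its complement to be
      combined.\<close>
    have "(card P - card ?V) ^ card c \<le> (card P - card c) ^ card c"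
      using cV fV by (intro power_mono diff_le_mono2 card_mono) auto
    also have "\<dots> \<le> card (?I c P)" by (rule card_injections_ge[OF fc fPQ(1)])
    finally have 1: "(card P - card ?V) ^ card c \<le> card (?I c P)" .
    have "(card Q - card ?V) ^ card (?V - c) \<le> (card Q - card (?V - c)) ^ card (?V - c)"
      using cV fV by (intro power_mono diff_le_mono2 card_mono) auto
    also have "\<dots> \<le> card (?I (?V - c) Q)" by (rule card_injections_ge[OF finite_Diff[OF fV] fPQ(2)])
    finally have 2: "(card Q - card ?V) ^ card (?V - c) \<le> card (?I (?V - c) Q)" .
    have "card (?I c P \<times> ?I (?V - c) Q) \<le> card (F c)"
    proof (rule card_inj_on_le[OF _ _ fF])
      show "inj_on ?j (?I c P \<times> ?I (?V - c) Q)"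
      proof (rule inj_onI, clarify)
        fix f g f' g'
        assume f: "f \<in> c \<rightarrow>\<^sub>E P" "f' \<in> c \<rightarrow>\<^sub>E P" and g: "g \<in> ?V - c \<rightarrow>\<^sub>E Q" "g' \<in> ?V - c \<rightarrow>\<^sub>E Q"
          and eq: "(\<lambda>x\<in>?V. if x \<in> c then f x else g x) = (\<lambda>x\<in>?V. if x \<in> c then f' x else g' x)"
        have "f x = f' x" if "x \<in> c" for x using fun_cong[OF eq, of x] that cV by auto
        moreover have "g x = g' x" if "x \<in> ?V - c" for x using fun_cong[OF eq, of x] that by auto
        ultimately show "f = f' \<and> g = g'" using PiE_ext f g by blast
      qed
      show "?j ` (?I c P \<times> ?I (?V - c) Q) \<subseteq> F c"
      proof clarify
        fix f g assume f: "f \<in> c \<rightarrow>\<^sub>E P" "inj_on f c" and g: "g \<in> ?V - c \<rightarrow>\<^sub>E Q" "inj_on g (?V - c)"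
        let ?h = "\<lambda>x\<in>?V. if x \<in> c then f x else g x"
        have hc: "?h x \<in> P" if "x \<in> c" for x using f that cV by auto
        have hd: "?h x \<in> Q" if "x \<in> ?V - c" for x using g that by auto
        have "?h x \<in> verts G" if "x \<in> ?V" for x
          using hc[of x] hd[of x] that PQ by (cases "x \<in> c") blast+
        then have "?h \<in> ?V \<rightarrow>\<^sub>E verts G" by (simp add: PiE_iff)
        moreover have "inj_on ?h ?V"
        proof (rule inj_onI)
          fix x y assume xy: "x \<in> ?V" "y \<in> ?V" "?h x = ?h y"
          then have "x \<in> c \<longleftrightarrow> y \<in> c" using hc[of x] hc[of y] hd[of x] hd[of y] PQ(3)
            by (metis DiffI IntI empty_iff)
          then show "x = y" using xy f(2) g(2) by (auto simp: inj_on_def split: if_splits)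
        qed
        moreover have "?h ` d \<in> edges G" if d: "d \<in> edges H" for d
        proof -
          obtain u v where uv: "u \<in> ?V" "v \<in> ?V" "d = {u, v}"
            using simple_graph_edgeE[OF H d] by metis
          have hd2: "?h ` d = {?h u, ?h v}" using uv(3) by blast
          have "u \<in> c \<longleftrightarrow> v \<notin> c" using c d uv by (simp add: two_colourings_def)
          then consider "u \<in> c" "v \<in> ?V - c" | "v \<in> c" "u \<in> ?V - c" using uv by blast
          then show ?thesis
          proof cases
            case 1
            then show ?thesis unfolding hd2 by (intro E hc hd)
          next
            case 2
            then show ?thesis unfolding hd2 insert_commute[of "?h u"] by (intro E hc hd)
          qed
        qed
        ultimately show "?h \<in> F c" using hc hd unfolding F_def embeddings_def by blast
      qed
    qed
    then show ?thesis
      using mult_le_mono[OF 1 2] by (simp add: card_cartesian_product)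
  qed
  then have "(\<Sum>c\<in>two_colourings H. (card P - card ?V) ^ card c * (card Q - card ?V) ^ card (?V - c))
      \<le> (\<Sum>c\<in>two_colourings H. card (F c))" by (rule sum_mono)
  also have "\<dots> = card (\<Union>(F ` two_colourings H))"
  proof (rule card_UN_disjoint[symmetric])
    show "\<forall>c\<in>two_colourings H. \<forall>d\<in>two_colourings H. c \<noteq> d \<longrightarrow> F c \<inter> F d = {}"
    proof (intro ballI impI)
      fix c d assume "c \<in> two_colourings H" "d \<in> two_colourings H" "c \<noteq> d"
      \<comment> \<open>An embedding in both families would send such an \<open>x\<close> into both
        \<open>P\<close> and \<open>Q\<close>.\<close>
      then have "(\<exists>x\<in>?V. x \<in> c \<and> x \<notin> d) \<or> (\<exists>x\<in>?V. x \<in> d \<and> x \<notin> c)"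
        by (auto simp: two_colourings_def)
      then show "F c \<inter> F d = {}" using PQ(3) unfolding F_def by blast
    qed
  qed (use fF finite_two_colourings[OF H] in auto)
  also have "\<dots> \<le> card (embeddings H G)"
    by (rule card_mono[OF finite_embeddings[OF H G]]) (auto simp: F_def)
  finally show ?thesis .
qed

section \<open>Graphs covered by a matching and leaves at one vertex\<close>

text \<open>Common form of both kinds of cover: with a star, \<open>s\<close> is its centre and one
  star edge belongs to \<open>M\<close>; without a star, \<open>L\<close> is empty and
  \<open>s\<close> is arbitrary, possibly outside \<open>verts B\<close>.\<close>

locale matching_cover =
  fixes B :: "'a graph" and M :: "'a set set" and L :: "'a set" and s :: 'a
  assumes simple: "simple_graph B"
    and matching: "M \<subseteq> edges B" "\<And>c d. c \<in> M \<Longrightarrow> d \<in> M \<Longrightarrow> c \<noteq> d \<Longrightarrow> c \<inter> d = {}"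
    and cover: "verts B = \<Union>M \<union> L" "\<Union>M \<inter> L = {}"
    and leaves: "\<And>l. l \<in> L \<Longrightarrow> {s, l} \<in> edges B"
begin

lemma finite_verts: "finite (verts B)"
  using simple by (simp add: simple_graph_def)

lemma finite_matching: "finite M"
  using finite_subset[OF matching(1) finite_edges[OF simple]] .

lemma finite_leaves: "finite L"
  using finite_verts cover by simp

lemma leaf_colour:
  assumes "c \<in> two_colourings B" "l \<in> L"
  shows "l \<in> c \<longleftrightarrow> s \<notin> c"
  using assms leaves[of l] by (auto simp: two_colourings_def)

lemma centre_in_verts: "L \<noteq> {} \<Longrightarrow> s \<in> verts B"
  using leaves edge_subset_verts[OF simple] by blast

text \<open>Each matching edge has exactly one end in \<open>c\<close>, and the leaves all have the
  colour opposite to that of \<open>s\<close>.\<close>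

lemma card_colour_class:
  assumes c: "c \<in> two_colourings B"
  shows "card c = card M + (if s \<in> c then 0 else card L)"
proof -
  have "card (\<Union>d\<in>M. c \<inter> d) = (\<Sum>d\<in>M. card (c \<inter> d))"
  proof (rule card_UN_disjoint[OF finite_matching])
    show "\<forall>d\<in>M. finite (c \<inter> d)"
      using c finite_verts by (auto simp: two_colourings_def intro: finite_subset)
  qed (use matching(2) in blast)
  also have "\<dots> = (\<Sum>d\<in>M. 1)"
  proof (rule sum.cong[OF refl])
    fix d assume "d \<in> M"
    then have d: "d \<in> edges B" using matching(1) by blast
    obtain u v where uv: "d = {u, v}" "u \<noteq> v" using simple_graph_edgeE[OF simple d] by metis
    then have "u \<in> c \<longleftrightarrow> v \<notin> c" using c d by (auto simp: two_colourings_def)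
    then show "card (c \<inter> d) = 1" using uv by (cases "u \<in> c") auto
  qed
  moreover have "(\<Union>d\<in>M. c \<inter> d) = c \<inter> \<Union>M" by blast
  ultimately have 1: "card (c \<inter> \<Union>M) = card M" by simp
  have 2: "c \<inter> L = (if s \<in> c then {} else L)" using leaf_colour[OF c] by auto
  have "c = (c \<inter> \<Union>M) \<union> (c \<inter> L)" using c cover by (auto simp: two_colourings_def)
  then have "card c = card (c \<inter> \<Union>M) + card (c \<inter> L)"
    using finite_verts cover by (subst card_Un_disjoint[symmetric]) auto
  then show ?thesis using 1 2 by simp
qed

text \<open>In a complementary pair of colourings, the leaves lie once in each class, so the two
  terms add up to a quantity independent of the colouring. The factor 2 arises from summing over
  pairs.\<close>

lemma two_card_embeddings_ge:
  assumes G: "simple_graph G"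
    and PQ: "P \<subseteq> verts G" "Q \<subseteq> verts G" "P \<inter> Q = {}"
    and E: "\<And>p q. p \<in> P \<Longrightarrow> q \<in> Q \<Longrightarrow> {p, q} \<in> edges G"
    and a: "a = card P - card (verts B)" and b: "b = card Q - card (verts B)"
  shows "card (two_colourings B) * ((a * b) ^ card M * (a ^ card L + b ^ card L))
    \<le> 2 * card (embeddings B G)"
proof -
  let ?g = "\<lambda>c. a ^ card c * b ^ card (verts B - c)"
  have "?g c + ?g (verts B - c) = (a * b) ^ card M * (a ^ card L + b ^ card L)"
    if c: "c \<in> two_colourings B" for c
  proof -
    note d = complement_two_colouring[OF simple c]
    have "verts B - (verts B - c) = c" using c by (auto simp: two_colourings_def)
    \<comment> \<open>If \<open>L\<close> is empty, \<open>s\<close> may lie in neither class, but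
      then both classes have size \<open>card M\<close> anyway.\<close>
    moreover have "s \<in> verts B - c \<longleftrightarrow> s \<notin> c" if "L \<noteq> {}" using centre_in_verts that by auto
    ultimately show ?thesis
      by (cases "L = {}"; cases "s \<in> c")
         (simp_all add: card_colour_class[OF c] card_colour_class[OF d] power_mult_distrib
           power_add algebra_simps)
  qed
  then have "card (two_colourings B) * ((a * b) ^ card M * (a ^ card L + b ^ card L))
      = (\<Sum>c\<in>two_colourings B. ?g c + ?g (verts B - c))" by simp
  also have "\<dots> = 2 * (\<Sum>c\<in>two_colourings B. ?g c)"
    by (simp only: sum.distrib sum_two_colourings_complement[OF simple, of ?g] mult_2)
  also have "\<dots> \<le> 2 * card (embeddings B G)"
    using card_embeddings_ge[OF simple G PQ E] by (simp add: a b)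
  finally show ?thesis .
qed

text \<open>
  For a fixed colouring, an embedding is determined by the edges of the host graph onto which it
  maps the matching edges together with its values on the remaining leaves.
\<close>

lemma two_card_embeddings_le:
  assumes G: "simple_graph G" and XY: "X \<inter> Y = {}" "X \<union> Y = verts G"
    and E: "\<forall>d\<in>edges G. \<exists>x\<in>X. \<exists>y\<in>Y. d = {x, y}"
  shows "2 * card (embeddings B G) \<le> card (two_colourings B) *
    (card (edges G) ^ card M * (card X ^ card L + card Y ^ card L))"
proof -
  define F where "F c = {f \<in> embeddings B G. {v \<in> verts B. f v \<in> X} = c}" for c
  \<comment> \<open>Here \<open>c\<close> is the set of vertices mapped into \<open>X\<close>, so
    the leaves go to \<open>Y\<close> exactly when \<open>s\<close> goes to \<open>X\<close>;
    \<open>h c\<close> counts the maps of \<open>L\<close> into that part.\<close>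
  define h where "h c = card (if s \<in> c then Y else X) ^ card L" for c
  have fXY: "finite X" "finite Y" using G XY by (auto simp: simple_graph_def dest: finite_subset[rotated])
  have opp: "x \<in> X \<longleftrightarrow> y \<notin> X" if "{x, y} \<in> edges G" for x y
    using E that XY(1) by (fastforce simp: doubleton_eq_iff)
  have U: "embeddings B G = (\<Union>c\<in>two_colourings B. F c)"
  proof (intro equalityI subsetI)
    fix f assume f: "f \<in> embeddings B G"
    have "{v \<in> verts B. f v \<in> X} \<in> two_colourings B"
      unfolding two_colourings_def
    proof (intro CollectI conjI allI impI)
      fix u v assume e: "{u, v} \<in> edges B"
      then have "f ` {u, v} \<in> edges G" using f by (auto simp: embeddings_def)
      then have "f u \<in> X \<longleftrightarrow> f v \<notin> X" using opp by simp
      moreover have "u \<in> verts B" "v \<in> verts B" using edge_subset_verts[OF simple e] by auto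
      ultimately show "u \<in> {v \<in> verts B. f v \<in> X} \<longleftrightarrow> v \<notin> {v \<in> verts B. f v \<in> X}" by simp
    qed blast
    then show "f \<in> (\<Union>c\<in>two_colourings B. F c)" using f by (auto simp: F_def)
  qed (auto simp: F_def)
  have F: "card (F c) \<le> card (edges G) ^ card M * h c" if c: "c \<in> two_colourings B" for c
  proof -
    let ?Z = "if s \<in> c then Y else X"
    let ?j = "\<lambda>f. (\<lambda>d\<in>M. f ` d, restrict f L)"
    have "card (F c) \<le> card ((M \<rightarrow>\<^sub>E edges G) \<times> (L \<rightarrow>\<^sub>E ?Z))"
    proof (rule card_inj_on_le[of ?j])
      show "?j ` F c \<subseteq> (M \<rightarrow>\<^sub>E edges G) \<times> (L \<rightarrow>\<^sub>E ?Z)"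
      proof clarify
        fix f assume f: "f \<in> F c"
        have "f ` d \<in> edges G" if "d \<in> M" for d
          using f that matching(1) by (auto simp: F_def embeddings_def)
        moreover have "f l \<in> ?Z" if l: "l \<in> L" for l
        proof -
          have lV: "l \<in> verts B" using l cover by blast
          then have "f l \<in> X \<union> Y" using f XY by (auto simp: F_def embeddings_def)
          moreover have "f l \<in> X \<longleftrightarrow> l \<in> c" using f lV by (auto simp: F_def)
          ultimately show ?thesis using leaf_colour[OF c l] by auto
        qed
        ultimately show "(\<lambda>d\<in>M. f ` d) \<in> M \<rightarrow>\<^sub>E edges G \<and> restrict f L \<in> L \<rightarrow>\<^sub>E ?Z" by simp
      qed
      show "inj_on ?j (F c)"
      proof (rule inj_onI)
        fix f g assume fg: "f \<in> F c" "g \<in> F c" and eq: "?j f = ?j g"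
        have fX: "f v \<in> X \<longleftrightarrow> v \<in> c" and gX: "g v \<in> X \<longleftrightarrow> v \<in> c" if "v \<in> verts B" for v
          using fg that by (auto simp: F_def)
        have "f v = g v" if v: "v \<in> verts B" for v
        proof (cases "v \<in> L")
          case True
          then show ?thesis using eq by (metis Pair_inject restrict_apply')
        next
          case False
          then obtain d where d: "d \<in> M" "v \<in> d" using v cover by auto
          then have dE: "d \<in> edges B" using matching(1) by blast
          obtain w where w: "d = {v, w}" "w \<in> verts B"
            using simple_graph_edgeE[OF simple dE] d(2) by (metis insertE insert_commute singletonD)
          have "v \<in> c \<longleftrightarrow> w \<notin> c" using c dE w by (simp add: two_colourings_def)
          \<comment> \<open>One of these values lies in \<open>X\<close> and the other does not. As
            both functions send \<open>{v, w}\<close> to the same edge, \<open>f v\<close> can only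
            be \<open>g v\<close>.\<close>
          then have "f v \<noteq> g w" using fX[OF v] gX[OF w(2)] by auto
          moreover have "f ` d = g ` d" using eq d(1) by (metis Pair_inject restrict_apply')
          ultimately show ?thesis using w by (auto simp: doubleton_eq_iff)
        qed
        then show "f = g" using fg PiE_ext unfolding F_def embeddings_def by blast
      qed
      show "finite ((M \<rightarrow>\<^sub>E edges G) \<times> (L \<rightarrow>\<^sub>E ?Z))"
        using fXY finite_matching finite_leaves finite_edges[OF G]
        by (intro finite_cartesian_product finite_PiE) auto
    qed
    then show ?thesis
      using finite_matching finite_leaves by (simp add: card_cartesian_product card_funcsetE h_def)
  qed
  have "card (embeddings B G) \<le> (\<Sum>c\<in>two_colourings B. card (F c))"
    unfolding U by (rule card_UN_le[OF finite_two_colourings[OF simple]])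
  also have "\<dots> \<le> (\<Sum>c\<in>two_colourings B. card (edges G) ^ card M * h c)"
    by (rule sum_mono[OF F])
  finally have "2 * card (embeddings B G) \<le> 2 * (\<Sum>c\<in>two_colourings B. card (edges G) ^ card M * h c)"
    by simp
  also have "\<dots> = (\<Sum>c\<in>two_colourings B. card (edges G) ^ card M * h c
      + card (edges G) ^ card M * h (verts B - c))"
    by (simp only: sum.distrib mult_2
        sum_two_colourings_complement[OF simple, of "\<lambda>c. card (edges G) ^ card M * h c"])
  also have "\<dots> = (\<Sum>c\<in>two_colourings B. card (edges G) ^ card M * (card X ^ card L + card Y ^ card L))"
  proof (rule sum.cong[OF refl])
    fix c
    have "h c + h (verts B - c) = card X ^ card L + card Y ^ card L"
      using centre_in_verts by (cases "L = {}") (simp_all add: h_def)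
    then show "card (edges G) ^ card M * h c + card (edges G) ^ card M * h (verts B - c)
        = card (edges G) ^ card M * (card X ^ card L + card Y ^ card L)"
      by (simp flip: distrib_left)
  qed
  finally show ?thesis by simp
qed

end

text \<open>The edge from the centre \<open>s\<close> to one leaf \<open>l\<close> is disjoint from
  \<open>M\<close>, hence can be added to the matching; the other leaves of the star form
  \<open>L\<close>.\<close>

lemma matching_cover_exists:
  assumes simple: "simple_graph B" and "edges_and_star_cover B"
  obtains M L s where "matching_cover B M L s"
proof -
  obtain M where M: "M \<subseteq> edges B" "\<forall>c\<in>M. \<forall>d\<in>M. c \<noteq> d \<longrightarrow> c \<inter> d = {}"
    and or: "verts B = \<Union>M \<or> (\<exists>S j. j \<ge> 2 \<and> subgraph S B \<and> isomorphic S (star j) \<and>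
         verts S \<inter> \<Union>M = {} \<and> verts B = verts S \<union> \<Union>M)"
    using assms(2) unfolding edges_and_star_cover_def by (elim exE conjE) (rule that)
  from or show thesis
  proof
    assume "verts B = \<Union>M"
    then have "matching_cover B M {} undefined"
      using simple M by unfold_locales auto
    then show thesis by (rule that)
  next
    assume "\<exists>S j. j \<ge> 2 \<and> subgraph S B \<and> isomorphic S (star j) \<and>
         verts S \<inter> \<Union>M = {} \<and> verts B = verts S \<union> \<Union>M"
    then obtain S j where S: "j \<ge> 2" "subgraph S B" "isomorphic S (star j)"
         "verts S \<inter> \<Union>M = {}" "verts B = verts S \<union> \<Union>M" by blast
    obtain f where b: "bij_betw f (verts S) {0..j}"
      and e: "\<And>u v. u \<in> verts S \<Longrightarrow> v \<in> verts S \<Longrightarrow> {u, v} \<in> edges S \<longleftrightarrow> {f u, f v} \<in> edges (star j)"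
      using S(3) unfolding isomorphic_def by (auto simp: star_def)
    \<comment> \<open>In \<open>star j\<close> the centre is \<open>0\<close>; \<open>1\<close>
      serves as the leaf whose edge joins the matching.\<close>
    have "0 \<in> f ` verts S" "1 \<in> f ` verts S" using b S(1) by (auto simp: bij_betw_def)
    then obtain s l where s: "s \<in> verts S" "f s = 0" and l: "l \<in> verts S" "f l = 1" by force
    have sl: "{s, v} \<in> edges B" if v: "v \<in> verts S" "v \<noteq> s" for v
    proof -
      have "f v \<noteq> 0" using b v s by (metis bij_betw_inv_into_left)
      moreover have "f v \<in> {0..j}" using b v(1) by (rule bij_betw_apply)
      ultimately have "{f s, f v} \<in> edges (star j)" using s by (auto simp: star_def)
      then show ?thesis using e s v S(2) by (auto simp: subgraph_def)
    qed
    have "l \<noteq> s" using s l by auto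
    have "matching_cover B (insert {s, l} M) (verts S - {s, l}) s"
    proof
      show "insert {s, l} M \<subseteq> edges B" using M(1) sl[OF l(1) \<open>l \<noteq> s\<close>] by simp
      have "{s, l} \<inter> d = {}" if "d \<in> M" for d using S(4) s l that by blast
      then show "c \<inter> d = {}" if "c \<in> insert {s, l} M" "d \<in> insert {s, l} M" "c \<noteq> d" for c d
        using that M(2) by blast
      show "verts B = \<Union>(insert {s, l} M) \<union> (verts S - {s, l})" using S(5) s l by auto
      show "\<Union>(insert {s, l} M) \<inter> (verts S - {s, l}) = {}" using S(4) by auto
    qed (use simple sl in auto)
    then show thesis by (rule that)
  qed
qed

section \<open>Part sizes and the comparison with \<open>B_graph\<close>\<close>

text \<open>Convexity of the power function: with fixed sum, spreading the two arguments apart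
  increases the sum of powers.\<close>

lemma power_sum_le_spread:
  fixes a b x y k :: nat
  assumes "x + y = a + b" "a \<le> x" "a \<le> y"
  shows "x ^ k + y ^ k \<le> a ^ k + b ^ k"
proof -
  obtain d where d: "x = a + d" using assms le_Suc_ex by blast
  then have "b = y + d" using assms by simp
  moreover have "(a + d) ^ k + y ^ k \<le> a ^ k + (y + d) ^ k"
  proof (induction k)
    case (Suc k)
    obtain c where c: "y = a + c" using assms(3) le_Suc_ex by blast
    \<comment> \<open>With \<open>y = a + c\<close>, the left side for \<open>Suc k\<close> is this
      left side plus \<open>d * (a + d) ^ k + c * y ^ k\<close>, and the right side is this right
      side plus \<open>(c + d) * (y + d) ^ k\<close>.\<close>
    have "a * ((a + d) ^ k + y ^ k) \<le> a * (a ^ k + (y + d) ^ k)"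
      by (rule mult_le_mono2[OF Suc])
    moreover have "d * (a + d) ^ k \<le> d * (y + d) ^ k" "c * y ^ k \<le> c * (y + d) ^ k"
      using assms(3) by (intro mult_le_mono2 power_mono; simp)+
    ultimately show ?case unfolding power_Suc c by (simp only: distrib_left distrib_right)
  qed simp
  ultimately show ?thesis using d by simp
qed

lemma part_size_le:
  assumes "0 < i" "e \<le> i * (n - i)"
  shows "part_size n e \<le> i"
  unfolding part_size_def using assms by (auto intro: Least_le)

text \<open>The product \<open>i * (n - i)\<close> is symmetric, so \<open>n - part_size n e\<close>
  also competes in the minimum that defines \<open>part_size n e\<close>.\<close>

lemma part_size_le_other:
  assumes "0 < e" "4 * e \<le> n ^ 2"
  shows "part_size n e \<le> n - part_size n e"
  using part_size[OF assms] by (intro part_size_le) (auto simp: mult.commute)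

text \<open>Since \<open>e\<close> is at most \<open>card X * card Y\<close> and the two sizes add
  up to \<open>n\<close>, both compete in the minimum that defines
  \<open>part_size n e\<close>.\<close>

lemma bip_graphs_parts:
  assumes "G \<in> bip_graphs n e" "0 < e"
  obtains X Y where "X \<inter> Y = {}" "X \<union> Y = verts G" "\<forall>d\<in>edges G. \<exists>x\<in>X. \<exists>y\<in>Y. d = {x, y}"
    "card X + card Y = n" "part_size n e \<le> card X" "part_size n e \<le> card Y"
proof -
  obtain X Y where XY: "X \<inter> Y = {}" "X \<union> Y = verts G"
    and E: "\<forall>d\<in>edges G. \<exists>x\<in>X. \<exists>y\<in>Y. d = {x, y}"
    using assms unfolding bip_graphs_def bipartite_def by blast
  have fin: "finite X" "finite Y"
    using assms XY by (auto simp: bip_graphs_def simple_graph_def dest: finite_subset[rotated])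
  then have n: "card X + card Y = n"
    using assms XY by (auto simp: bip_graphs_def card_Un_disjoint[symmetric])
  have "edges G \<subseteq> (\<lambda>(x, y). {x, y}) ` (X \<times> Y)" using E by fastforce
  then have "card (edges G) \<le> card (X \<times> Y)" using fin by (intro surj_card_le) auto
  then have e: "e \<le> card X * card Y" using assms by (simp add: bip_graphs_def card_cartesian_product)
  then have pos: "0 < card X" "0 < card Y" using assms(2) by (auto intro: gr0I)
  have "n - card X = card Y" "n - card Y = card X" using n by auto
  then show thesis using that[OF XY E n] e pos part_size_le by (metis mult.commute)
qed

text \<open>Only vertex \<open>0\<close> lacks edges; without it a complete bipartite graph
  remains.\<close>

lemma B_graph_lower:
  assumes "0 < e" "4 * e \<le> n ^ 2" "u \<in> {1..<part_size n e}" "v \<in> {part_size n e..<n}"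
  shows "{u, v} \<in> edges (B_graph n e)"
  using assms part_size(2)[OF assms(1,2)]
  by (auto simp: B_graph_def complete_bip_def Let_def doubleton_eq_iff)

text \<open>The upper bound for \<open>G\<close> and the lower bound for \<open>B_graph n e\<close>
  are values of the same homogeneous polynomial of degree \<open>2 * card M + card L\<close>, at
  \<open>(t, r)\<close> and at \<open>(a, b)\<close>. The second point dominates the first scaled by
  \<open>1 - w / t\<close>. The number \<open>w\<close> accounts for the vertices of
  \<open>B\<close> and the avoided vertex \<open>0\<close>.\<close>

lemma (in matching_cover) num_copies_le_B_graph:
  fixes n e
  defines "t \<equiv> part_size n e" and "w \<equiv> card (verts B) + 1"
  assumes e: "0 < e" "4 * e \<le> n ^ 2" and G: "G \<in> bip_graphs n e" and w: "w \<le> t"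
  shows "(1 - real w / real t) ^ (2 * card M + card L) * real (num_copies B G)
    \<le> real (num_copies B (B_graph n e))"
proof -
  define r where "r = n - t"
  define a where "a = t - 1 - card (verts B)"
  define b where "b = r - card (verts B)"
  define \<rho> where "\<rho> = 1 - real w / real t"
  let ?m = "card M" and ?k = "card L" and ?T = "card (two_colourings B)"
  let ?p = "2 * ?m + ?k"
  note t = part_size[OF e, folded t_def]
  have tr: "t \<le> r" using part_size_le_other[OF e] by (simp add: t_def r_def)
  have tn: "t + r = n" using t by (simp add: r_def)
  have sB: "simple_graph (B_graph n e)"
    using B_graph_in_bip_graphs[OF e] by (simp add: bip_graphs_def)
  have vB: "verts (B_graph n e) = {..<n}"
    using tn by (simp add: B_graph_def complete_bip_def Let_def r_def t_def)
  have lower: "?T * ((a * b) ^ ?m * (a ^ ?k + b ^ ?k)) \<le> 2 * card (embeddings B (B_graph n e))"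
  proof (rule two_card_embeddings_ge[OF sB])
    show "{1..<t} \<subseteq> verts (B_graph n e)" "{t..<n} \<subseteq> verts (B_graph n e)"
      unfolding vB using t(2) by auto
    show "{u, v} \<in> edges (B_graph n e)" if "u \<in> {1..<t}" "v \<in> {t..<n}" for u v
      using B_graph_lower[OF e] that by (simp add: t_def)
  qed (auto simp: a_def b_def r_def)
  have sG: "simple_graph G" and eG: "card (edges G) = e" using G by (auto simp: bip_graphs_def)
  obtain X Y where XY: "X \<inter> Y = {}" "X \<union> Y = verts G" "\<forall>d\<in>edges G. \<exists>x\<in>X. \<exists>y\<in>Y. d = {x, y}"
    and n: "card X + card Y = n" "t \<le> card X" "t \<le> card Y"
    using bip_graphs_parts[OF G e(1)] unfolding t_def by metis
  have "2 * card (embeddings B G) \<le> ?T * (e ^ ?m * (card X ^ ?k + card Y ^ ?k))"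
    using two_card_embeddings_le[OF sG XY] eG by simp
  also have "\<dots> \<le> ?T * ((t * r) ^ ?m * (t ^ ?k + r ^ ?k))"
    using t n tn by (intro mult_le_mono2 mult_le_mono power_mono power_sum_le_spread) (auto simp: r_def)
  finally have upper: "2 * card (embeddings B G) \<le> ?T * ((t * r) ^ ?m * (t ^ ?k + r ^ ?k))" .
  have \<rho>: "0 \<le> \<rho>" using w t by (simp add: \<rho>_def)
  have a: "\<rho> * t = a" using w t by (simp add: \<rho>_def a_def w_def field_simps of_nat_diff)
  \<comment> \<open>On the larger part, \<open>\<rho>\<close> removes \<open>w * r / t\<close>,
    which is at least \<open>w\<close> because \<open>t\<close> is at most \<open>r\<close>.\<close>
  have "real w * 1 \<le> real w * (r / t)" using tr t by (intro mult_left_mono) auto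
  then have "\<rho> * r \<le> r - w" by (simp add: \<rho>_def algebra_simps)
  also have "\<dots> \<le> b" using w tr by (simp add: b_def w_def of_nat_diff)
  finally have b: "\<rho> * r \<le> b" .
  have "\<rho> ^ ?p * (2 * card (embeddings B G)) \<le> \<rho> ^ ?p * (?T * ((t * r) ^ ?m * (t ^ ?k + r ^ ?k)))"
    using \<rho> upper by (intro mult_left_mono of_nat_mono) auto
  also have "\<dots> = ?T * (((\<rho> * t) * (\<rho> * r)) ^ ?m * ((\<rho> * t) ^ ?k + (\<rho> * r) ^ ?k))"
    by (simp add: power_add power_mult power_mult_distrib power2_eq_square algebra_simps)
  also have "\<dots> \<le> ?T * ((real a * real b) ^ ?m * (real a ^ ?k + real b ^ ?k))"
    unfolding a using b \<rho>
    by (intro mult_left_mono mult_mono add_mono power_mono zero_le_power add_nonneg_nonneg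
        mult_nonneg_nonneg order_refl) auto
  also have "\<dots> = real (?T * ((a * b) ^ ?m * (a ^ ?k + b ^ ?k)))" by simp
  also have "\<dots> \<le> real (2 * card (embeddings B (B_graph n e)))"
    using lower by (rule of_nat_mono)
  finally have "\<rho> ^ ?p * card (embeddings B G) \<le> card (embeddings B (B_graph n e))" by simp
  then have "(\<rho> ^ ?p * num_copies B G) * card (isomorphisms B B)
      \<le> num_copies B (B_graph n e) * card (isomorphisms B B)"
    by (simp add: card_embeddings[OF simple sG] card_embeddings[OF simple sB] mult.assoc)
  then show ?thesis
    using card_isomorphisms_pos[OF simple] by (simp add: \<rho>_def)
qed

section \<open>Passage to the limit\<close>

lemma asymp_equiv_sandwich_ratio:
  fixes f g \<rho> :: "nat \<Rightarrow> real"
  assumes "\<rho> \<longlonglongrightarrow> 1" and "\<forall>\<^sub>F n in at_top. 0 \<le> g n \<and> \<rho> n * g n \<le> f n \<and> f n \<le> g n"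
  shows "f \<sim>[at_top] g"
  unfolding asymp_equiv_def
proof (rule tendsto_sandwich[OF _ _ _ tendsto_const])
  let ?q = "\<lambda>n. if f n = 0 \<and> g n = 0 then 1 else f n / g n"
  \<comment> \<open>The minimum covers the indices with \<open>f n = g n = 0\<close>, where the
    quotient is set to 1 while \<open>\<rho> n\<close> may exceed 1.\<close>
  show "(\<lambda>n. min 1 (\<rho> n)) \<longlonglongrightarrow> 1" using tendsto_min[OF tendsto_const assms(1), of 1] by simp
  have "\<forall>\<^sub>F n in at_top. min 1 (\<rho> n) \<le> ?q n \<and> ?q n \<le> 1"
    using assms(2)
  proof eventually_elim
    case (elim n)
    then show ?case by (cases "g n = 0") (auto simp: field_simps min_le_iff_disj)
  qed
  then show "\<forall>\<^sub>F n in at_top. min 1 (\<rho> n) \<le> ?q n" "\<forall>\<^sub>F n in at_top. ?q n \<le> 1"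
    by (auto elim: eventually_mono)
qed

theorem theorem1p4:
  fixes B :: "'a graph" and e :: "nat \<Rightarrow> nat"
  assumes "simple_graph B" and "bipartite B" and "edges_and_star_cover B"
    and "filterlim (\<lambda>n. real (e n) / real n) at_top at_top"
    and "\<forall>\<^sub>F n in at_top. real (e n) \<le> (real n)\<^sup>2 / 4"
  shows "(\<lambda>n. real (ex_bip n (e n) B)) \<sim>[at_top]
         (\<lambda>n. real (num_copies B (B_graph n (e n))))"
proof -
  obtain M L s where "matching_cover B M L s"
    using matching_cover_exists assms by blast
  then interpret matching_cover B M L s .
  define t where "t n = part_size n (e n)" for n
  define w where "w = card (verts B) + 1"
  let ?p = "2 * card M + card L"
  have pos: "\<forall>\<^sub>F n in at_top. 0 < e n"
    using filterlim_at_top_dense[THEN iffD1, OF assms(4), rule_format, of 0]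
    by (auto elim!: eventually_mono intro: gr0I)
  have le: "\<forall>\<^sub>F n in at_top. 4 * e n \<le> n ^ 2"
    using assms(5)
  proof eventually_elim
    case (elim n)
    then have "real (4 * e n) \<le> real (n ^ 2)" by simp
    then show ?case by (simp only: of_nat_le_iff)
  qed
  \<comment> \<open>The smaller part has size at least \<open>e n / n\<close>, because
    \<open>e n\<close> is at most \<open>t n * (n - t n)\<close>.\<close>
  have t: "filterlim (\<lambda>n. real (t n)) at_top at_top"
  proof (rule filterlim_at_top_mono[OF assms(4)])
    show "\<forall>\<^sub>F n in at_top. real (e n) / real n \<le> real (t n)"
      using pos le
    proof eventually_elim
      case (elim n)
      have "e n \<le> t n * (n - t n)" using part_size[OF elim] by (simp add: t_def)
      also have "\<dots> \<le> t n * n" by simp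
      finally have "real (e n) \<le> real (t n) * real n" by (simp flip: of_nat_mult)
      moreover have "0 < n" using elim by (auto intro: gr0I)
      ultimately show ?case by (simp add: field_simps)
    qed
  qed
  then have "(\<lambda>n. real w / real (t n)) \<longlonglongrightarrow> 0"
    by (intro tendsto_divide_0[OF tendsto_const] filterlim_at_top_imp_at_infinity)
  from tendsto_power[OF tendsto_diff[OF tendsto_const[of 1] this], of ?p]
  have \<rho>: "(\<lambda>n. (1 - real w / real (t n)) ^ ?p) \<longlonglongrightarrow> 1" by simp
  have "\<forall>\<^sub>F n in at_top. real w \<le> real (t n)"
    using t unfolding filterlim_at_top by blast
  with pos le have "\<forall>\<^sub>F n in at_top. 0 \<le> real (ex_bip n (e n) B) \<and>
      (1 - real w / real (t n)) ^ ?p * real (ex_bip n (e n) B) \<le> real (num_copies B (B_graph n (e n))) \<and>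
      real (num_copies B (B_graph n (e n))) \<le> real (ex_bip n (e n) B)"
  proof eventually_elim
    case (elim n)
    let ?N = "num_copies B ` bip_graphs n (e n)"
    have mem: "num_copies B (B_graph n (e n)) \<in> ?N"
      using B_graph_in_bip_graphs elim by blast
    then have "ex_bip n (e n) B \<in> ?N"
      unfolding ex_bip_def by (intro Max_in finite_num_copies_bip_graphs) auto
    \<comment> \<open>The maximum is attained, so the comparison for a single host graph applies to
      \<open>ex_bip\<close>.\<close>
    then obtain G where G: "G \<in> bip_graphs n (e n)" "ex_bip n (e n) B = num_copies B G" by blast
    have "num_copies B (B_graph n (e n)) \<le> ex_bip n (e n) B"
      unfolding ex_bip_def by (rule Max_ge[OF finite_num_copies_bip_graphs mem])
    then show ?case
      using num_copies_le_B_graph[OF elim(1,2) G(1)] elim(3) G(2) by (simp add: t_def w_def)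
  qed
  then show ?thesis
    \<comment> \<open>The sandwich has the count for \<open>B_graph\<close> as the smaller function,
      hence the final symmetry.\<close>
    by (rule asymp_equiv_sandwich_ratio[OF \<rho>, THEN asymp_equiv_symI])
qed

end
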